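(* The unit interval $[0,1]$ (with its usual order) is not a Scott-continuous retract of the dcpo $P=2^{<\omega}\mathbin{\dot\cup}[0,1]$ (with the binary-expansion order defined in the context).
   Context: Let $T=2^{<\omega}$ be the set of finite binary words with the prefix order $\preccurlyeq$, and $X=2^\omega$ the set of infinite binary sequences. For $s\in T$, $[s]=\{\alpha\in X: s \text{ is a prefix of }\alpha\}$. Let $\pi:X\to[0,1]$, $\pi(\alpha)=\sum_{n=0}^\infty \alpha(n)/2^{n+1}$. The poset $P=T\mathbin{\dot\cup}[0,1]$ (disjoint union) is ordered by: for $s,t\in T$, $s\le t$ iff $s\preccurlyeq t$; for $s\in T$, $r\in[0,1]$, $s\le r$ iff $r\in\pi([s])$; for $r,q\in[0,1]$, $r\le q$ iff $r=q$; no other comparabilities. It is a dcpo (every nonempty directed subset has a supremum). A map between dcpos is Scott-continuous if it is monotone and preserves suprema of directed sets. $[0,1]$ (usual order) is a Scott-continuous retract of $P$ if there are Scott-continuous maps $f:P\to[0,1]$ and $g:[0,1]\to P$ with $f\circ g=\mathrm{id}_{[0,1]}$. *)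

theory Defs
  imports "HOL-Analysis.Analysis" "HOL-Library.Sublist" "HOL-Library.Lub_Glb"
begin

definition (in ord) directed :: "'a set \<Rightarrow> bool" where
  "directed D \<longleftrightarrow> D \<noteq> {} \<and> (\<forall>x\<in>D. \<forall>y\<in>D. \<exists>z\<in>D. x \<le> z \<and> y \<le> z)"

class dcpo = order +
  assumes directed_has_sup:
    "directed D \<Longrightarrow> \<exists>s. (\<forall>x\<in>D. x \<le> s) \<and> (\<forall>u. (\<forall>x\<in>D. x \<le> u) \<longrightarrow> s \<le> u)"

lemma isLub_UNIV_iff:
  "isLub UNIV D s \<longleftrightarrow> (\<forall>x\<in>D. x \<le> s) \<and> (\<forall>u. (\<forall>x\<in>D. x \<le> u) \<longrightarrow> s \<le> u)"
  by (auto simp: isLub_def leastP_def isUb_def setle_def setge_def)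

lemma directed_has_Lub: "directed (D :: 'a::dcpo set) \<Longrightarrow> \<exists>s. isLub UNIV D s"
  unfolding isLub_UNIV_iff by (rule directed_has_sup)

definition scott_continuous :: "('a::dcpo \<Rightarrow> 'b::dcpo) \<Rightarrow> bool" where
  "scott_continuous f \<longleftrightarrow>
     mono f \<and> (\<forall>D s. directed D \<and> isLub UNIV D s \<longrightarrow> isLub UNIV (f ` D) (f s))"

typedef unit_interval = "{0..1::real}"
  morphisms real_of_ui ui_of_real
  by (rule exI[of _ 0]) simp

instantiation unit_interval :: order
begin

definition less_eq_unit_interval :: "unit_interval \<Rightarrow> unit_interval \<Rightarrow> bool" where
  "x \<le> y \<longleftrightarrow> real_of_ui x \<le> real_of_ui y"

definition less_unit_interval :: "unit_interval \<Rightarrow> unit_interval \<Rightarrow> bool" where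
  "x < y \<longleftrightarrow> real_of_ui x < real_of_ui y"

instance
  by standard (auto simp: less_eq_unit_interval_def less_unit_interval_def real_of_ui_inject)

end

instance unit_interval :: dcpo
proof
  fix D :: "unit_interval set"
  assume "directed D"
  then obtain d where d: "d \<in> D" by (auto simp: directed_def)
  let ?R = "real_of_ui ` D"
  have bounds: "0 \<le> real_of_ui x" "real_of_ui x \<le> 1" for x
    using real_of_ui[of x] by auto
  have bdd: "bdd_above ?R" using bounds by (intro bdd_aboveI[of _ 1]) auto
  have "real_of_ui d \<le> Sup ?R" using d bdd by (intro cSup_upper) auto
  moreover have "Sup ?R \<le> 1" using d bounds by (intro cSup_least) auto
  ultimately have "Sup ?R \<in> {0..1}" using bounds(1)[of d] by auto
  then have r: "real_of_ui (ui_of_real (Sup ?R)) = Sup ?R" by (rule ui_of_real_inverse)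
  have "isLub UNIV D (ui_of_real (Sup ?R))"
    using d bdd
    by (auto simp: isLub_UNIV_iff
        less_eq_unit_interval_def r intro: cSup_upper cSup_least)
  then show "\<exists>s. (\<forall>x\<in>D. x \<le> s) \<and> (\<forall>u. (\<forall>x\<in>D. x \<le> u) \<longrightarrow> s \<le> u)"
    unfolding isLub_UNIV_iff ..
qed

definition cylinder :: "bool list \<Rightarrow> (nat \<Rightarrow> bool) set" where
  "cylinder s = {\<alpha>. \<forall>i<length s. \<alpha> i = s ! i}"

definition binval :: "(nat \<Rightarrow> bool) \<Rightarrow> real" where
  "binval \<alpha> = (\<Sum>n. of_bool (\<alpha> n) / 2 ^ (n + 1))"

lemma cylinder_Nil [simp]: "cylinder [] = UNIV"
  by (simp add: cylinder_def)

lemma cylinder_antimono: "prefix s t \<Longrightarrow> cylinder t \<subseteq> cylinder s"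
  by (auto simp: cylinder_def prefix_def nth_append)

lemma geometric_half_sums: "(\<lambda>n. 1 / 2 ^ (n + 1) :: real) sums 1"
  using power_half_series by (simp add: power_divide)

lemma binval_summable: "summable (\<lambda>n. of_bool (\<alpha> n) / 2 ^ (n + 1) :: real)"
  by (rule summable_comparison_test[OF _ sums_summable[OF geometric_half_sums]])
     (auto intro!: exI[of _ 0])

lemma binval_bounds: "binval \<alpha> \<in> {0..1}"
proof -
  have "binval \<alpha> \<le> (\<Sum>n. 1 / 2 ^ (n + 1))"
    unfolding binval_def
    by (intro suminf_le binval_summable sums_summable[OF geometric_half_sums])
       (auto simp: divide_simps)
  moreover have "0 \<le> binval \<alpha>"
    unfolding binval_def by (intro suminf_nonneg binval_summable) auto
  ultimately show ?thesis
    using sums_unique[OF geometric_half_sums] by simp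
qed

lemma binval_split:
  "binval \<alpha> = (\<Sum>n<k. of_bool (\<alpha> n) / 2 ^ (n + 1)) + binval (\<lambda>n. \<alpha> (n + k)) / 2 ^ k"
proof -
  have "binval \<alpha> = (\<Sum>n. of_bool (\<alpha> (n + k)) / 2 ^ (n + k + 1)) + (\<Sum>n<k. of_bool (\<alpha> n) / 2 ^ (n + 1))"
    unfolding binval_def by (rule suminf_split_initial_segment[OF binval_summable])
  also have "(\<Sum>n. of_bool (\<alpha> (n + k)) / 2 ^ (n + k + 1) :: real)
      = (\<Sum>n. (of_bool (\<alpha> (n + k)) / 2 ^ (n + 1)) / 2 ^ k)"
    by (simp add: power_add mult_ac)
  also have "\<dots> = binval (\<lambda>n. \<alpha> (n + k)) / 2 ^ k"
    unfolding binval_def using binval_summable[of "\<lambda>n. \<alpha> (n + k)"] by (rule suminf_divide)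
  finally show ?thesis by simp
qed

lemma binval_cylinder_dist:
  assumes "\<alpha> \<in> cylinder s" "\<beta> \<in> cylinder s"
  shows "\<bar>binval \<alpha> - binval \<beta>\<bar> \<le> (1 / 2) ^ length s"
proof -
  let ?k = "length s"
  let ?a = "binval (\<lambda>n. \<alpha> (n + ?k))" and ?b = "binval (\<lambda>n. \<beta> (n + ?k))"
  have "(\<Sum>n<?k. of_bool (\<alpha> n) / 2 ^ (n + 1)) = (\<Sum>n<?k. of_bool (\<beta> n) / 2 ^ (n + 1) :: real)"
    using assms by (intro sum.cong) (auto simp: cylinder_def)
  then have "binval \<alpha> - binval \<beta> = (?a - ?b) / 2 ^ ?k"
    using binval_split[of \<alpha> ?k] binval_split[of \<beta> ?k] by (simp add: diff_divide_distrib)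
  moreover have "\<bar>?a - ?b\<bar> \<le> 1"
    using binval_bounds[of "\<lambda>n. \<alpha> (n + ?k)"] binval_bounds[of "\<lambda>n. \<beta> (n + ?k)"] by auto
  ultimately show ?thesis by (simp add: power_divide divide_simps)
qed

datatype tree_interval = Word "bool list" | Pt unit_interval

instantiation tree_interval :: order
begin

fun less_eq_tree_interval :: "tree_interval \<Rightarrow> tree_interval \<Rightarrow> bool" where
  "Word s \<le> Word t \<longleftrightarrow> prefix s t"
| "Word s \<le> Pt r \<longleftrightarrow> real_of_ui r \<in> binval ` cylinder s"
| "Pt r \<le> Pt q \<longleftrightarrow> r = q"
| "Pt r \<le> Word s \<longleftrightarrow> False"

definition less_tree_interval :: "tree_interval \<Rightarrow> tree_interval \<Rightarrow> bool" where
  "x < y \<longleftrightarrow> x \<le> y \<and> \<not> y \<le> x" for x y :: tree_interval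

instance
proof
  fix x y z :: tree_interval
  show "x < y \<longleftrightarrow> x \<le> y \<and> \<not> y \<le> x" by (rule less_tree_interval_def)
  show "x \<le> x" by (cases x) auto
  show "x \<le> z" if "x \<le> y" "y \<le> z"
    using that cylinder_antimono
    by (cases x; cases y; cases z) (auto intro: prefix_order.trans)
  show "x = y" if "x \<le> y" "y \<le> x"
    using that by (cases x; cases y) (auto intro: prefix_order.antisym)
qed

end

lemma prefix_nth: "prefix s t \<Longrightarrow> i < length s \<Longrightarrow> s ! i = t ! i"
  by (auto simp: prefix_def nth_append)

instance tree_interval :: dcpo
proof
  fix D :: "tree_interval set"
  assume dir: "directed D"
  show "\<exists>s. (\<forall>x\<in>D. x \<le> s) \<and> (\<forall>u. (\<forall>x\<in>D. x \<le> u) \<longrightarrow> s \<le> u)"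
  proof (cases "\<exists>m\<in>D. \<forall>x\<in>D. x \<le> m")
    case True
    then obtain m where "m \<in> D" "\<forall>x\<in>D. x \<le> m" by blast
    then show ?thesis by (intro exI[of _ m]) auto
  next
    case no_max: False
    have no_pt: "Pt r \<notin> D" for r
    proof
      assume r: "Pt r \<in> D"
      have max: "x \<le> Pt r" if x: "x \<in> D" for x
      proof -
        obtain z where "x \<le> z" "Pt r \<le> z" using dir r x by (metis directed_def)
        then show ?thesis by (cases z) simp_all
      qed
      show False using r max no_max by metis
    qed
    define W where "W = {s. Word s \<in> D}"
    have D: "D = Word ` W"
      unfolding W_def
    proof safe
      fix x assume "x \<in> D"
      then show "x \<in> Word ` {s. Word s \<in> D}" using no_pt by (cases x) auto
    qed
    have W_dir: "\<exists>u\<in>W. prefix s u \<and> prefix t u" if "s \<in> W" "t \<in> W" for s t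
      using dir that unfolding directed_def D by auto
    have W_ne: "W \<noteq> {}" using dir unfolding directed_def D by auto
    have W_long: "\<exists>s\<in>W. n \<le> length s" for n
    proof (induction n)
      case 0
      then show ?case using W_ne by auto
    next
      case (Suc n)
      then obtain s where s: "s \<in> W" "n \<le> length s" by auto
      then obtain t where t: "t \<in> W" "\<not> prefix t s" using no_max unfolding D by auto
      obtain u where u: "u \<in> W" "prefix s u" "prefix t u" using W_dir s(1) t(1) by blast
      have "length s < length u"
      proof (rule ccontr)
        assume "\<not> length s < length u"
        then have "u = s" using u(2) by (auto simp: prefix_def)
        then show False using u(3) t(2) by simp
      qed
      then show ?case using u(1) s(2) by (auto intro!: bexI[of _ u])
    qed
    define \<alpha> where "\<alpha> i = (SOME s. s \<in> W \<and> i < length s) ! i" for i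
    have \<alpha>: "\<alpha> \<in> cylinder s" if s: "s \<in> W" for s
      unfolding cylinder_def
    proof (clarify)
      fix i assume i: "i < length s"
      let ?t = "SOME s. s \<in> W \<and> i < length s"
      have t: "?t \<in> W \<and> i < length ?t" 
        using that i by (intro someI[where P = "\<lambda>s. s \<in> W \<and> i < length s" and x = s]) auto
      obtain u where "prefix s u" "prefix ?t u" using W_dir[OF s, of ?t] t by auto
      then have "?t ! i = u ! i" "s ! i = u ! i"
        using i t prefix_nth[of _ u i] by auto
      then show "\<alpha> i = s ! i" by (simp add: \<alpha>_def)
    qed
    define r where "r = ui_of_real (binval \<alpha>)"
    have r: "real_of_ui r = binval \<alpha>"
      unfolding r_def by (rule ui_of_real_inverse[OF binval_bounds])
    have ub: "x \<le> Pt r" if "x \<in> D" for x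
      using that \<alpha> r unfolding D by auto
    have least: "Pt r \<le> y" if y: "\<forall>x\<in>D. x \<le> y" for y
    proof (cases y)
      case (Word t)
      obtain s where "s \<in> W" "Suc (length t) \<le> length s" using W_long by blast
      then show ?thesis using y prefix_length_le[of s t] unfolding D Word by auto
    next
      case (Pt q)
      have small: "\<bar>real_of_ui q - real_of_ui r\<bar> \<le> (1 / 2) ^ n" for n
      proof -
        obtain s where s: "s \<in> W" "n \<le> length s" using W_long by blast
        then obtain \<beta> where "\<beta> \<in> cylinder s" "real_of_ui q = binval \<beta>"
          using y unfolding D Pt by auto
        then have "\<bar>real_of_ui q - real_of_ui r\<bar> \<le> (1 / 2) ^ length s"
          using binval_cylinder_dist \<alpha>[OF s(1)] r by simp
        also have "\<dots> \<le> (1 / 2) ^ n" using s(2) by (intro power_decreasing) auto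
        finally show ?thesis .
      qed
      have "real_of_ui q = real_of_ui r"
      proof (rule ccontr)
        assume "\<not> ?thesis"
        then obtain n where "(1 / 2 :: real) ^ n < \<bar>real_of_ui q - real_of_ui r\<bar>"
          using real_arch_pow_inv[of "\<bar>real_of_ui q - real_of_ui r\<bar>" "1 / 2"] by auto
        then show False using small[of n] by linarith
      qed
      then show ?thesis using Pt by (simp add: real_of_ui_inject)
    qed
    show ?thesis by (intro exI[of _ "Pt r"] conjI ballI allI impI) (simp_all add: ub least)
  qed
qed

text \<open>The first type is a Scott-continuous retract of the second one; the type
  arguments only name the two dcpos.\<close>

definition scott_retract :: "'a::dcpo itself \<Rightarrow> 'b::dcpo itself \<Rightarrow> bool" where
  "scott_retract A P \<longleftrightarrow>
     (\<exists>(f :: 'b \<Rightarrow> 'a) (g :: 'a \<Rightarrow> 'b).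
        scott_continuous f \<and> scott_continuous g \<and> f \<circ> g = id)"

end

theory Submission
  imports Defs
begin

text \<open>A section \<open>g\<close> would be an order embedding of \<open>[0,1]\<close>. Since points of the interval
  part of \<open>P\<close> are maximal, \<open>g 0.5 < g 1\<close> must be a word, which has only finitely many elements
  below it; but \<open>g\<close> embeds the infinite set \<open>[0,0.5]\<close> below it.\<close>

lemma Pt_le_iff: "Pt r \<le> y \<longleftrightarrow> y = Pt r"
  by (cases y) auto

text \<open>No point lies below a word, so everything below \<open>Word w\<close> comes from one of
  the finitely many prefixes of \<open>w\<close>.\<close>

lemma finite_atMost_Word: "finite {..Word w}"
proof (rule finite_subset)
  show "{..Word w} \<subseteq> Word ` set (prefixes w)"
  proof
    fix x assume "x \<in> {..Word w}"
    then show "x \<in> Word ` set (prefixes w)" by (cases x) auto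
  qed
qed simp

text \<open>\<open>real_of_ui\<close> maps \<open>{..a}\<close> onto a nondegenerate real
  interval.\<close>

lemma infinite_atMost_ui:
  assumes "0 < real_of_ui a"
  shows "infinite {..a}"
proof
  assume "finite {..a}"
  moreover have "{0..real_of_ui a} \<subseteq> real_of_ui ` {..a}"
  proof
    fix x assume x: "x \<in> {0..real_of_ui a}"
    then have "real_of_ui (ui_of_real x) = x"
      using real_of_ui[of a] by (intro ui_of_real_inverse) auto
    then show "x \<in> real_of_ui ` {..a}"
      using x by (intro image_eqI[of _ _ "ui_of_real x"]) (auto simp: less_eq_unit_interval_def)
  qed
  ultimately have "finite {0..real_of_ui a}"
    by (blast intro: finite_subset)
  then show False
    using assms by (simp add: infinite_Icc)
qed

theorem theorem3p18:
  shows "\<not> scott_retract TYPE(unit_interval) TYPE(tree_interval)"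
proof
  assume "scott_retract TYPE(unit_interval) TYPE(tree_interval)"
  then obtain f :: "tree_interval \<Rightarrow> unit_interval" and g :: "unit_interval \<Rightarrow> tree_interval"
    where g: "mono g" and fg: "f \<circ> g = id"
    unfolding scott_retract_def scott_continuous_def by blast
  from fg have inj: "inj g"
    by (metis inj_on_id inj_on_imageI2)
  \<comment> \<open>Any value strictly between 0 and 1 would do for \<open>a\<close>: being below 1
    keeps \<open>g a\<close> from being maximal, being positive makes \<open>{..a}\<close>
    infinite.\<close>
  define a where "a = ui_of_real (1 / 2)"
  define b where "b = ui_of_real 1"
  have a: "real_of_ui a = 1 / 2" and b: "real_of_ui b = 1"
    by (simp_all add: a_def b_def ui_of_real_inverse)
  have "g a \<le> g b"
    using g a b by (simp add: monoD less_eq_unit_interval_def)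
  moreover have "g a \<noteq> g b"
    using inj a b by (auto dest: injD)
  ultimately obtain w where "g a = Word w"
    by (metis Pt_le_iff tree_interval.exhaust)
  then have "g ` {..a} \<subseteq> {..Word w}"
    using g by (auto dest: monoD)
  then have "finite (g ` {..a})"
    using finite_atMost_Word by (rule finite_subset)
  then have "finite {..a}"
    using inj by (blast intro: finite_imageD inj_on_subset)
  then show False
    using infinite_atMost_ui a by simp
qed

end
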